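(* Let $p$ be a prime number and $k$ a field of characteristic $p$. Let $f(\zeta)$ be a parabolic power series in $k[[\zeta]]$, and denote by $q$ the order of $f'(0)$. If $p$ is odd, then $f$ is minimally ramified if and only if $$ i_0(f^q)=q \quad\text{and}\quad \operatorname{r\acute{e}sit}(f)\neq 0. $$ If $p=2$, then $f$ is minimally ramified if and only if $$ i_0(f^q)=q,\quad \operatorname{r\acute{e}sit}(f)\neq 0,\quad\text{and}\quad \operatorname{r\acute{e}sit}(f)\neq 1. $$
   Context: Powers of power series denote iterates under composition. A power series $f(\zeta)\in k[[\zeta]]$ is parabolic if $f(0)=0$ and $f'(0)$ is a root of unity; its order $q$ is not divisible by $p$. For a nonzero power series, $\operatorname{ord}$ is the lowest degree of its nonzero terms, and $\operatorname{ord}(0)=+\infty$. For $g\in k[[\zeta]]$ with $g(0)=0$, $g'(0)=1$, and each integer $n\ge0$, put $i_n(g):=\operatorname{ord}\left(\frac{g^{p^n}(\zeta)-\zeta}{\zeta}\right)$. A parabolic $f$, with $q$ the order of $f'(0)$, is called minimally ramified if $i_n(f^q)=q\,\frac{p^{n+1}-1}{p-1}$ for every integer $n\ge0$. Iterative residue $\operatorname{r\acute{e}sit}(f)\in k$, defined for a parabolic $f\in k[[\zeta]]$ with $i_0(f^q)=q$: (1) If $f'(0)=1$ (so $q=1$), write $f(\zeta)=\zeta(1+a_1\zeta+a_2\zeta^2+\cdots)$; then $a_1\ne0$ and $\operatorname{r\acute{e}sit}(f):=1-\frac{a_2}{a_1^2}$. (2) If $\gamma:=f'(0)\neq 1$ (so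 $q\ge 2$), then $f$ is conjugated (by an invertible power series in $k[[\zeta]]$ fixing $0$) to a power series of the form $g(\zeta)=\gamma\zeta\left(1+\sum_{j=1}^{+\infty}a_j\zeta^{jq}\right)$; the hypothesis $i_0(f^q)=q$ implies $a_1\neq0$, and $\operatorname{r\acute{e}sit}(f):=\frac{q+1}{2}-\frac{a_2}{a_1^2}$, which depends only on $f$ and not on the choice of $g$. When $p=2$ the integer $q$ is odd, so $\frac{q+1}{2}$ is an integer and defines an element of $k$. The conditions on $\operatorname{r\acute{e}sit}(f)$ are to be read as applying once $i_0(f^q)=q$ holds. *)

theory Defs
  imports "HOL-Computational_Algebra.Computational_Algebra" "HOL-Library.Extended_Nat"
begin

definition mult_order :: "'a::field \<Rightarrow> nat" where
  "mult_order x = (LEAST n. n > 0 \<and> x ^ n = 1)"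

definition parabolic :: "'a::field fps \<Rightarrow> bool" where
  "parabolic f \<longleftrightarrow> fps_nth f 0 = 0 \<and> (\<exists>n>0. fps_nth f 1 ^ n = 1)"

definition fps_iter :: "'a::field fps \<Rightarrow> nat \<Rightarrow> 'a fps" where
  "fps_iter f n = ((\<lambda>g. f oo g) ^^ n) fps_X"

text \<open>In contrast to \<^const>\<open>subdegree\<close>, the zero series has infinite order here.\<close>

definition fps_ord :: "'a::field fps \<Rightarrow> enat" where
  "fps_ord f = (if f = 0 then \<infinity> else enat (subdegree f))"

text \<open>The number \<open>i\<^sub>n(g)\<close>, for the prime \<open>p\<close>.\<close>

definition ram_number :: "nat \<Rightarrow> nat \<Rightarrow> 'a::field fps \<Rightarrow> enat" where
  "ram_number p n g = fps_ord ((fps_iter g (p ^ n) - fps_X) div fps_X)"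

text \<open>The natural-number division is exact when \<open>p \<ge> 2\<close>.\<close>

definition minimally_ramified :: "nat \<Rightarrow> 'a::field fps \<Rightarrow> bool" where
  "minimally_ramified p f \<longleftrightarrow> parabolic f \<and>
     (let q = mult_order (fps_nth f 1)
      in \<forall>n. ram_number p n (fps_iter f q) = enat (q * ((p ^ (n + 1) - 1) div (p - 1))))"

definition fps_conjugate :: "'a::field fps \<Rightarrow> 'a fps \<Rightarrow> bool" where
  "fps_conjugate f g \<longleftrightarrow> (\<exists>h. fps_nth h 0 = 0 \<and> fps_nth h 1 \<noteq> 0 \<and> h oo f = g oo h)"

text \<open>The series \<open>\<gamma>\<zeta>(1 + a\<^sub>1\<zeta>\<^sup>q + a\<^sub>2\<zeta>\<^sup>2\<^sup>q + \<dots>)\<close>, whose coefficients \<open>a\<^sub>j\<close>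
  (\<open>j \<ge> 1\<close>) are those of \<open>A\<close>; it is used only for \<open>fps_nth A 0 = 0\<close> and \<open>q > 0\<close>.\<close>

definition normal_series :: "'a::field \<Rightarrow> nat \<Rightarrow> 'a fps \<Rightarrow> 'a fps" where
  "normal_series \<gamma> q A = fps_const \<gamma> * fps_X * (1 + (A oo fps_X ^ q))"

text \<open>The element \<open>(q + 1) / 2\<close> of the field. In characteristic 2 the division has to be
  carried out in the integers, where it is exact because \<open>q\<close> is then odd; in any other
  characteristic \<open>q\<close> may be even and the division is that of the field.\<close>

definition half_succ :: "nat \<Rightarrow> 'a::field" where
  "half_succ q = (if CHAR('a) = 2 then of_nat ((q + 1) div 2) else of_nat (q + 1) / 2)"

text \<open>Meaningful only for parabolic \<open>f\<close> with \<open>i\<^sub>0(f\<^sup>q) = q\<close>. Then, if \<open>\<gamma> \<noteq> 1\<close>, a series \<open>A\<close>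
  as below exists, and the value does not depend on which one is chosen.\<close>

definition resit :: "'a::field fps \<Rightarrow> 'a" where
  "resit f = (let \<gamma> = fps_nth f 1; q = mult_order \<gamma> in
     if \<gamma> = 1 then 1 - fps_nth f 3 / (fps_nth f 2)\<^sup>2
     else (let A = (SOME A. fps_nth A 0 = 0 \<and> fps_conjugate f (normal_series \<gamma> q A))
           in half_succ q - fps_nth A 2 / (fps_nth A 1)\<^sup>2))"

end

theory Submission imports Defs begin

text \<open>
  If \<open>h \<circ> f = g \<circ> h\<close> with \<open>ord h\<close> prime to \<open>p\<close>, then the ramification numbers of \<open>f\<close> are those of
  \<open>g\<close> times \<open>ord h\<close>. Composing the conjugation to normal form with \<open>\<zeta> \<mapsto> \<zeta>\<^sup>q\<close> therefore reduces
  everything to a series \<open>F(\<zeta>) = \<zeta> + a\<zeta>\<^sup>2 + b\<zeta>\<^sup>3 + \<dots>\<close>, and \<open>a\<^sup>2 - b\<close> is then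
  \<open>a\<^sup>2/q\<close> times the iterative residue of \<open>f\<close>.

  For \<open>g\<close> tangent to the identity write \<open>1/g = 1/\<zeta> + t\<close>; then \<open>i\<^sub>0(g) = ord t + 1\<close>. With
  \<open>\<delta>\<phi> = \<phi> \<circ> g - \<phi>\<close>, the \<open>p\<close>-th iterate has increment \<open>\<delta>\<^bsup>p-1\<^esup>t\<close> in characteristic \<open>p\<close>. If
  \<open>t = c\<zeta>\<^sup>e + c'\<zeta>\<^bsup>e+1\<^esup> + \<dots>\<close> with \<open>p | e\<close>, the term \<open>c\<zeta>\<^sup>e\<close> is negligible by Frobenius, and a
  two-term expansion gives \<open>\<delta>\<^bsup>p-1\<^esup>t = k c c' \<zeta>\<^bsup>p(e+1)\<^esup> + k c'\<^sup>2 \<zeta>\<^bsup>p(e+1)+1\<^esup> + \<dots>\<close> with \<open>k \<noteq> 0\<close>, except that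
  for \<open>p = 2\<close> and \<open>e = 0\<close> the second coefficient is \<open>k c' (c' - c\<^sup>2)\<close>. So once the two leading
  coefficients are nonzero they stay nonzero, and the orders grow at the minimal rate. For \<open>F\<close> one
  starts with \<open>e = 0\<close>, \<open>c = -a\<close> and \<open>c' = a\<^sup>2 - b\<close>.
\<close>

subsection \<open>Two-term expansions\<close>

text \<open>\<open>a\<close> and \<open>b\<close> may vanish, so \<open>m\<close> only bounds the
  order from below; expansions can be propagated first and their leading coefficients inspected
  afterwards.\<close>

definition jet2 :: "'a::field fps \<Rightarrow> nat \<Rightarrow> 'a \<Rightarrow> 'a \<Rightarrow> bool" where
  "jet2 f m a b \<longleftrightarrow> (\<forall>k<m. fps_nth f k = 0) \<and> fps_nth f m = a \<and> fps_nth f (Suc m) = b"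

lemma jet2_add: "jet2 f m a b \<Longrightarrow> jet2 g m c d \<Longrightarrow> jet2 (f + g) m (a + c) (b + d)"
  by (simp add: jet2_def)

lemma jet2_uminus: "jet2 f m a b \<Longrightarrow> jet2 (- f) m (- a) (- b)"
  by (simp add: jet2_def)

lemma jet2_mult:
  assumes "jet2 f m a b" "jet2 g n c d"
  shows "jet2 (f * g) (m + n) (a * c) (a * d + b * c)"
proof -
  define f' where "f' = fps_shift m f"
  define g' where "g' = fps_shift n g"
  have f: "f = fps_X ^ m * f'" and g: "g = fps_X ^ n * g'"
    using assms by (auto simp: f'_def g'_def jet2_def fps_eq_iff fps_X_power_mult_nth)
  have "f * g = fps_X ^ (m + n) * (f' * g')"
    by (simp add: f g power_add ac_simps)
  moreover have "fps_nth (f' * g') 0 = a * c" "fps_nth (f' * g') (Suc 0) = a * d + b * c"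
    using assms by (simp_all add: fps_mult_nth f'_def g'_def jet2_def)
  ultimately show ?thesis
    by (simp add: jet2_def fps_X_power_mult_nth)
qed

lemma jet2_X_power: "jet2 (fps_X ^ m) m 1 0"
  by (simp add: jet2_def)

text \<open>Induction on \<open>m\<close>, splitting one factor \<open>g\<close> off. The square
  term is special to \<open>d = 1\<close>: only then does g have a \<zeta>^2 term r\<zeta>^2 that
  interferes with the second recorded degree.\<close>

lemma jet2_power_diff:
  fixes g :: "'a::field fps"
  assumes g: "jet2 (g - fps_X) (Suc d) r s" and d: "d > 0"
  shows "jet2 (g ^ m - fps_X ^ m) (m + d) (of_nat m * r)
           (of_nat m * s + (if d = 1 then of_nat (m choose 2) * r\<^sup>2 else 0))"
proof (induction m)
  case 0
  show ?case by (simp add: jet2_def numeral_2_eq_2)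
next
  case (Suc m)
  have gX: "jet2 g 1 1 (if d = 1 then r else 0)"
  proof -
    have "jet2 (g - fps_X) 1 0 (if d = 1 then r else 0)"
      using g d by (auto simp: jet2_def)
    from jet2_add[OF this jet2_X_power[of 1]] show ?thesis by simp
  qed
  have 1: "g ^ Suc m - fps_X ^ Suc m = g * (g ^ m - fps_X ^ m) + fps_X ^ m * (g - fps_X)"
    by (simp add: algebra_simps)
  have "jet2 (g * (g ^ m - fps_X ^ m) + fps_X ^ m * (g - fps_X)) (Suc m + d)
     (1 * (of_nat m * r) + 1 * r)
     (1 * (of_nat m * s + (if d = 1 then of_nat (m choose 2) * r\<^sup>2 else 0)) +
        (if d = 1 then r else 0) * (of_nat m * r) + (1 * s + 0 * r))"
    using jet2_add[OF jet2_mult[OF gX Suc.IH]] jet2_mult[OF jet2_X_power[of m] g] by simp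
  moreover have "Suc m choose 2 = (m choose 2) + m"
    by (simp add: numeral_2_eq_2)
  ultimately show ?case
    unfolding 1 by (auto simp: algebra_simps power2_eq_square)
qed

section \<open>The difference operator \<delta>\<close>

definition fps_delta :: "'a::field fps \<Rightarrow> 'a fps \<Rightarrow> 'a fps" where
  "fps_delta g f = (f oo g) - f"

lemma fps_delta_nth:
  "fps_nth (fps_delta g f) n = (\<Sum>i=0..n. fps_nth f i * fps_nth (g ^ i - fps_X ^ i) n)"
proof -
  have "fps_nth (fps_delta g f) n = fps_nth (f oo g) n - fps_nth (f oo fps_X) n"
    by (simp only: fps_delta_def fps_sub_nth fps_compose_fps_X)
  also have "\<dots> = (\<Sum>i=0..n. fps_nth f i * fps_nth (g ^ i - fps_X ^ i) n)"
    unfolding fps_compose_nth by (simp add: sum_subtractf[symmetric] algebra_simps)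
  finally show ?thesis .
qed

text \<open>The second-order term at \<open>m \<equiv> -1\<close> modulo the characteristic does not depend on \<open>b\<close>, so
  on reaching such an \<open>m\<close> only the leading coefficient has to be known.\<close>

lemma jet2_delta:
  fixes g :: "'a::field fps"
  assumes g: "jet2 (g - fps_X) (Suc d) r s" and d: "d > 0" and f: "jet2 f m a b"
  shows "jet2 (fps_delta g f) (m + d) (of_nat m * r * a)
           ((of_nat m * s + (if d = 1 then of_nat (m choose 2) * r\<^sup>2 else 0)) * a
             + of_nat (Suc m) * r * b)"
proof -
  note P = jet2_power_diff[OF g d, unfolded jet2_def]
  \<comment> \<open>In degree n only indices m \<le> i \<le> n - d contribute: smaller ones are
    killed by \<open>f\<close>, larger ones by \<open>g ^ i - fps_X ^ i\<close>. This leaves one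
    term in degree m + d and two in the next.\<close>
  have z: "fps_nth f i * fps_nth (g ^ i - fps_X ^ i) n = 0" if "i < m \<or> n < i + d" for i n
    using that P[of i] f by (auto simp: jet2_def)
  have "fps_nth (fps_delta g f) n = 0" if "n < m + d" for n
    unfolding fps_delta_nth using that by (intro sum.neutral ballI z) auto
  moreover have "fps_nth (fps_delta g f) (m + d) = of_nat m * r * a"
  proof -
    have "fps_nth (fps_delta g f) (m + d) =
        (\<Sum>i\<in>{m}. fps_nth f i * fps_nth (g ^ i - fps_X ^ i) (m + d))"
      unfolding fps_delta_nth
      by (intro sum.mono_neutral_right ballI z) auto
    thus ?thesis using P[of m] f by (simp add: jet2_def)
  qed
  moreover have "fps_nth (fps_delta g f) (Suc (m + d)) =
      (of_nat m * s + (if d = 1 then of_nat (m choose 2) * r\<^sup>2 else 0)) * a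
             + of_nat (Suc m) * r * b"
  proof -
    have "fps_nth (fps_delta g f) (Suc (m + d)) =
        (\<Sum>i\<in>{m, Suc m}. fps_nth f i * fps_nth (g ^ i - fps_X ^ i) (Suc (m + d)))"
      unfolding fps_delta_nth using d
      by (intro sum.mono_neutral_right ballI z) auto
    thus ?thesis using P[of m] P[of "Suc m"] f by (simp add: jet2_def del: of_nat_Suc)
  qed
  ultimately show ?thesis by (simp add: jet2_def)
qed

lemma fps_delta_add: "fps_delta g (f + h) = fps_delta g f + fps_delta g h"
  by (simp add: fps_delta_def fps_compose_add_distrib)

lemma fps_delta_const_mult: "fps_delta g (fps_const c * f) = fps_const c * fps_delta g f"
  by (simp add: fps_delta_def fps_eq_iff fps_compose_nth sum_distrib_left algebra_simps)

lemma fps_delta_of_nat_mult: "fps_delta g (of_nat c * f) = of_nat c * fps_delta g f"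
  using fps_delta_const_mult[of g "of_nat c" f] by (simp add: fps_of_nat)

lemma fps_delta_sum: "fps_delta g (sum f A) = (\<Sum>i\<in>A. fps_delta g (f i))"
  by (simp add: fps_delta_def fps_compose_sum_distrib sum_subtractf)

lemma fps_delta_funpow_add:
  "(fps_delta g ^^ n) (f + h) = (fps_delta g ^^ n) f + (fps_delta g ^^ n) h"
  by (induction n) (simp_all add: fps_delta_add)

lemma jet2_delta_funpow_zero:
  assumes g: "jet2 (g - fps_X) (Suc d) r s" and d: "d > 0" and f: "jet2 f m 0 0"
  shows "jet2 ((fps_delta g ^^ n) f) (m + n * d) 0 0"
proof (induction n)
  case (Suc n)
  from jet2_delta[OF g d Suc.IH] show ?case by (simp add: algebra_simps)
qed (use f in simp)

text \<open>In the field, the exponent after j steps equals j + 1; these successive factors build up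
  n!.\<close>

lemma jet2_delta_funpow:
  assumes g: "jet2 (g - fps_X) (Suc d) r s" and d: "d > 0" and f: "jet2 f m a b"
    and d1: "of_nat d = (1::'a::field)" and m1: "of_nat m = (1::'a)"
  shows "\<exists>b'. jet2 ((fps_delta g ^^ n) f) (m + n * d) (of_nat (fact n) * r ^ n * (a::'a)) b'"
proof (induction n)
  case 0
  show ?case using f by auto
next
  case (Suc n)
  then obtain b' where b': "jet2 ((fps_delta g ^^ n) f) (m + n * d) (of_nat (fact n) * r ^ n * a) b'"
    by blast
  have "of_nat (m + n * d) = (of_nat (Suc n) :: 'a)"
    using d1 m1 by simp
  hence 1: "of_nat (m + n * d) * r * (of_nat (fact n) * r ^ n * a)
      = of_nat (fact (Suc n)) * r ^ Suc n * a"
    by (simp only: fact_Suc of_nat_mult of_nat_id power_Suc ac_simps)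
  have 2: "m + n * d + d = m + Suc n * d"
    by simp
  show ?case
    using jet2_delta[OF g d b'] unfolding 1 2 funpow.simps o_apply by (rule exI)
qed

subsection \<open>Increments of the reciprocal\<close>

text \<open>The condition says \<open>1/g = 1/\<zeta> + t\<close>, cleared of denominators. In the coordinate \<open>u = 1/\<zeta>\<close>
  the map \<open>g\<close> is thus \<open>u \<mapsto> u + t\<close>, so increments add up along an orbit.\<close>

definition inv_incr :: "'a::field fps \<Rightarrow> 'a fps \<Rightarrow> bool" where
  "inv_incr g t \<longleftrightarrow> g * (1 + fps_X * t) = fps_X"

text \<open>This is 1/(h o g) = 1/g + u o g = 1/\<zeta> + t + u o g, cleared of
  denominators.\<close>

lemma inv_incr_compose:
  assumes g: "inv_incr g t" and h: "inv_incr h u" and g0: "fps_nth g 0 = 0"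
  shows "inv_incr (h oo g) (t + (u oo g))"
proof -
  have "(h * (1 + fps_X * u)) oo g = fps_X oo g"
    using h by (simp add: inv_incr_def)
  hence "(h oo g) * (1 + g * (u oo g)) = g"
    using g0 by (simp add: fps_compose_mult_distrib fps_compose_add_distrib)
  hence "(h oo g) * ((1 + g * (u oo g)) * (1 + fps_X * t)) = fps_X"
    using g by (simp only: inv_incr_def mult.assoc[symmetric])
  also have "(1 + g * (u oo g)) * (1 + fps_X * t)
      = 1 + fps_X * t + (g * (1 + fps_X * t)) * (u oo g)"
    by (simp add: algebra_simps)
  also have "\<dots> = 1 + fps_X * (t + (u oo g))"
    using g by (simp add: inv_incr_def algebra_simps)
  finally show ?thesis by (simp add: inv_incr_def)
qed

text \<open>Write g = \<zeta>w with w(0) = 1; then t = (1/w - 1)/\<zeta> is a power series.\<close>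

lemma ex_inv_incr:
  assumes "fps_nth g 0 = 0" "fps_nth g 1 = 1"
  shows "\<exists>t. inv_incr g t"
proof -
  define w where "w = fps_shift 1 g"
  have g: "g = fps_X * w"
    using assms by (auto simp: w_def fps_eq_iff)
  have w0: "fps_nth w 0 = 1" using assms by (simp add: w_def)
  define t where "t = fps_shift 1 (inverse w)"
  have "inverse w = 1 + fps_X * t"
    using w0 by (auto simp: t_def fps_eq_iff)
  hence "w * (1 + fps_X * t) = 1"
    using w0 by (metis inverse_mult_eq_1' one_neq_zero)
  thus ?thesis by (auto simp: inv_incr_def g mult.assoc)
qed

lemma fps_iter_0 [simp]: "fps_iter f 0 = fps_X"
  by (simp add: fps_iter_def)

lemma fps_iter_Suc: "fps_iter f (Suc n) = f oo fps_iter f n"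
  by (simp add: fps_iter_def)

lemma fps_iter_nth_0: "fps_nth f 0 = 0 \<Longrightarrow> fps_nth (fps_iter f n) 0 = 0"
  by (cases n) (simp_all add: fps_iter_Suc)

lemma fps_nth_1_compose:
  "fps_nth g 0 = 0 \<Longrightarrow> fps_nth (f oo g) (Suc 0) = fps_nth f (Suc 0) * fps_nth g (Suc 0)"
  by (simp add: fps_compose_nth)

lemma fps_iter_nth_1: "fps_nth f 0 = 0 \<Longrightarrow> fps_nth (fps_iter f n) (Suc 0) = fps_nth f (Suc 0) ^ n"
  by (induction n) (simp_all add: fps_iter_Suc fps_nth_1_compose fps_iter_nth_0)

lemma fps_iter_add:
  assumes "fps_nth f 0 = 0"
  shows "fps_iter f (m + n) = fps_iter f m oo fps_iter f n"
  by (induction m) (use assms in \<open>simp_all add: fps_iter_Suc fps_compose_assoc fps_iter_nth_0\<close>)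

lemma fps_iter_mult:
  assumes "fps_nth f 0 = 0"
  shows "fps_iter f (m * n) = fps_iter (fps_iter f m) n"
  by (induction n) (use assms in \<open>simp_all add: fps_iter_Suc fps_iter_add\<close>)

lemma fps_iter_1 [simp]: "fps_nth f 0 = 0 \<Longrightarrow> fps_iter f (Suc 0) = f"
  by (simp add: fps_iter_Suc)

text \<open>Newton's forward difference formula: the increments t o g^i with i < n add up, and
  composition with g is the operator 1 + \<delta>.\<close>

lemma inv_incr_iter:
  assumes g: "inv_incr g t" and g0: "fps_nth g 0 = 0"
  shows "inv_incr (fps_iter g n) (\<Sum>j<n. of_nat (n choose Suc j) * (fps_delta g ^^ j) t)"
proof (induction n)
  case 0
  show ?case by (simp add: inv_incr_def)
next
  case (Suc n)
  define S where "S = (\<Sum>j<n. of_nat (n choose Suc j) * (fps_delta g ^^ j) t)"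
  have "inv_incr (fps_iter g n oo g) (t + (S oo g))"
    using inv_incr_compose[OF g Suc.IH g0] by (simp add: S_def)
  moreover have "fps_iter g n oo g = fps_iter g (Suc n)"
    using fps_iter_add[OF g0, of n 1] g0 by simp
  moreover have "t + (S oo g) = (\<Sum>j<Suc n. of_nat (Suc n choose Suc j) * (fps_delta g ^^ j) t)"
  proof -
    have 1: "t + fps_delta g S = (\<Sum>j<Suc n. of_nat (n choose j) * (fps_delta g ^^ j) t)"
      unfolding S_def fps_delta_sum fps_delta_of_nat_mult
      by (subst sum.lessThan_Suc_shift) simp
    have 2: "S = (\<Sum>j<Suc n. of_nat (n choose Suc j) * (fps_delta g ^^ j) t)"
      by (simp add: S_def binomial_eq_0)
    have "t + (S oo g) = (t + fps_delta g S) + S"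
      by (simp add: fps_delta_def)
    also have "\<dots> = (\<Sum>j<Suc n. of_nat (n choose j) * (fps_delta g ^^ j) t) +
        (\<Sum>j<Suc n. of_nat (n choose Suc j) * (fps_delta g ^^ j) t)"
      by (rule arg_cong2[where f = "(+)", OF 1 2])
    also have "\<dots> = (\<Sum>j<Suc n. of_nat (Suc n choose Suc j) * (fps_delta g ^^ j) t)"
      unfolding sum.distrib[symmetric]
      by (intro sum.cong refl) (simp only: binomial_Suc_Suc of_nat_add distrib_right)
    finally show ?thesis .
  qed
  ultimately show ?case by simp
qed

lemma inv_incr_iter_char:
  fixes g :: "'a::field fps"
  assumes g: "inv_incr g t" and g0: "fps_nth g 0 = 0" and p: "prime p" "CHAR('a) = p"
  shows "inv_incr (fps_iter g p) ((fps_delta g ^^ (p - 1)) t)"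
proof -
  have "(\<Sum>j<p. of_nat (p choose Suc j) * (fps_delta g ^^ j) t)
      = (\<Sum>j\<in>{p-1}. of_nat (p choose Suc j) * (fps_delta g ^^ j) t)"
  proof (intro sum.mono_neutral_right ballI)
    fix j assume "j \<in> {..<p} - {p - 1}"
    hence "p dvd (p choose Suc j)"
      using p by (intro dvd_choose_prime) auto
    hence "of_nat (p choose Suc j) = (0 :: 'a fps)"
      using p by (simp add: of_nat_eq_0_iff_char_dvd)
    thus "of_nat (p choose Suc j) * (fps_delta g ^^ j) t = 0" by simp
  qed (use prime_gt_0_nat[OF p(1)] in auto)
  also have "\<dots> = (fps_delta g ^^ (p - 1)) t"
    using prime_gt_0_nat[OF p(1)] by simp
  finally show ?thesis using inv_incr_iter[OF g g0, of p] by simp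
qed

text \<open>Clearing denominators gives g - \<zeta> = -\<zeta>tg. For \<open>e = 0\<close> the
  \<zeta>^2 coefficient -c of g feeds back into the next degree and yields c^2.\<close>

lemma jet2_of_inv_incr:
  assumes g: "inv_incr g t" and t: "jet2 t e c c'" and g0: "fps_nth g 0 = 0"
  shows "jet2 (g - fps_X) (Suc (Suc e)) (- c) (- c' + (if e = 0 then c\<^sup>2 else 0))"
proof -
  have gX: "g - fps_X = - (fps_X * t * g)"
    using g unfolding inv_incr_def by (simp add: algebra_simps eq_diff_eq)
  have g1: "fps_nth g (Suc 0) = 1"
    using arg_cong[OF gX, of "\<lambda>x. fps_nth x 1"] g0 by (simp add: fps_mult_nth)
  have "fps_nth g (Suc (Suc 0)) = - fps_nth t 0"
    using arg_cong[OF gX, of "\<lambda>x. fps_nth x 2"] g0 g1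
    by (simp add: numeral_2_eq_2 mult.assoc fps_mult_nth)
  hence "jet2 g 1 1 (if e = 0 then - c else 0)"
    using g0 g1 t by (auto simp: jet2_def)
  from jet2_uminus[OF jet2_mult[OF jet2_mult[OF jet2_X_power[of 1] t] this]] show ?thesis
    unfolding gX by (auto simp: power2_eq_square)
qed

section \<open>Positive characteristic: Frobenius and the p-th iterate\<close>

lemma jet2_zero_mono: "jet2 f m 0 0 \<Longrightarrow> n \<le> m \<Longrightarrow> jet2 f n 0 0"
  by (cases "n = m"; cases "Suc n = m") (auto simp: jet2_def)

lemma fps_power_nth_below:
  assumes "\<forall>k<m. fps_nth f k = 0" and "k < m * n"
  shows "fps_nth (f ^ n) k = (0::'a::field)"
proof -
  have "f = fps_X ^ m * fps_shift m f"
    using assms by (auto simp: fps_eq_iff fps_X_power_mult_nth)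
  hence "f ^ n = fps_X ^ (m * n) * fps_shift m f ^ n"
    by (metis power_mult power_mult_distrib)
  thus ?thesis using assms by (simp add: fps_X_power_mult_nth)
qed

text \<open>With e = ip, Frobenius gives g^e - \<zeta>^e = (g^i - \<zeta>^i)^p, of order at least
  p(i + d) = e + pd.\<close>

lemma fps_delta_X_power_char:
  fixes g :: "'a::field fps"
  assumes g: "jet2 (g - fps_X) (Suc d) r s" and d: "d > 0" and g0: "fps_nth g 0 = 0"
    and p: "prime p" "CHAR('a) = p" and e: "p dvd e" and k: "k < e + p * d"
  shows "fps_nth (fps_delta g (fps_X ^ e)) k = 0"
proof -
  obtain i where i: "e = i * p" using e by (metis dvdE mult.commute)
  have frob: "(x - y) ^ p = x ^ p - y ^ p" for x y :: "'a fps"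
  proof -
    have "(x - y + y) ^ p = (x - y) ^ p + y ^ p"
      by (rule freshmans_dream) (use p in auto)
    thus ?thesis by (simp add: algebra_simps)
  qed
  have "fps_delta g (fps_X ^ e) = (g ^ i) ^ p - (fps_X ^ i) ^ p"
    using g0 by (simp add: fps_delta_def i fps_X_power_compose flip: power_mult)
  also have "\<dots> = (g ^ i - fps_X ^ i) ^ p"
    by (simp add: frob)
  finally have "fps_delta g (fps_X ^ e) = (g ^ i - fps_X ^ i) ^ p" .
  moreover have "fps_nth ((g ^ i - fps_X ^ i) ^ p) k = 0"
    using jet2_power_diff[OF g d, of i] k i
    by (intro fps_power_nth_below[where m = "i + d"]) (auto simp: jet2_def algebra_simps)
  ultimately show ?thesis by simp
qed

lemma of_nat_char_diff1:
  assumes "prime p" "CHAR('a) = p"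
  shows "of_nat (p - 1) = (- 1 :: 'a::field)"
proof -
  have "of_nat (p - 1) + 1 = (of_nat p :: 'a)"
    using prime_gt_0_nat[OF assms(1)] by (metis Suc_diff_1 add.commute of_nat_Suc)
  thus ?thesis using assms(2) by (metis add_eq_0_iff2 of_nat_CHAR)
qed

lemma of_nat_char_choose2:
  assumes p: "prime p" "CHAR('a) = p" and p2: "p \<noteq> 2"
  shows "of_nat ((p - 1) choose 2) = (1 :: 'a::field)"
proof -
  have p3: "p > 2" using p2 prime_ge_2_nat[OF p(1)] by simp
  have "p choose 2 = ((p - 1) choose 2) + (p - 1)"
    using p3 by (cases p) (simp_all add: numeral_2_eq_2)
  moreover have "p dvd (p choose 2)"
    using p p3 by (intro dvd_choose_prime) auto
  ultimately have "of_nat ((p - 1) choose 2) + of_nat (p - 1) = (0::'a)"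
    using p by (metis of_nat_add of_nat_eq_0_iff_char_dvd)
  thus ?thesis using of_nat_char_diff1[OF p] by simp
qed

text \<open>The term c\<zeta>^e and the rest \<open>u\<close> of t are treated separately. On
  \<open>u\<close>, p - 2 applications of \<delta> reach the exponent (p - 1)d, which is -1 in the
  field, so the last application needs only the leading coefficient. The witness is k = (p - 2)!
  (-c)^(p - 2).\<close>

lemma jet2_delta_funpow_char:
  fixes g :: "'a::field fps"
  assumes p: "prime p" "CHAR('a) = p" and g0: "fps_nth g 0 = 0"
    and gt: "inv_incr g t" and t: "jet2 t e c c'" and e: "p dvd e"
  shows "\<exists>k. (c \<noteq> 0 \<longrightarrow> k \<noteq> 0) \<and> jet2 ((fps_delta g ^^ (p - 1)) t) (p * Suc e)
           (k * c * c') (k * c' * (if e = 0 \<and> p = 2 then c' - c\<^sup>2 else c'))"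
proof -
  define r where "r = - c"
  define s where "s = - c' + (if e = 0 then c\<^sup>2 else 0)"
  define d where "d = Suc e"
  have d0: "d > 0" by (simp add: d_def)
  have g: "jet2 (g - fps_X) (Suc d) r s"
    using jet2_of_inv_incr[OF gt t g0] by (simp add: d_def r_def s_def)
  have d1: "of_nat d = (1::'a)"
    using e p by (auto simp: d_def of_nat_eq_0_iff_char_dvd)
  have p2: "p \<ge> 2" using p prime_ge_2_nat by blast
  define n where "n = p - 2"
  have n: "p - 1 = Suc n" using p2 by (simp add: n_def)
  define u where "u = t - fps_const c * fps_X ^ e"
  have u: "jet2 u d c' (fps_nth t (Suc d))"
    using t by (auto simp: jet2_def u_def d_def less_Suc_eq)
  define k where "k = of_nat (fact n) * r ^ n"
  \<comment> \<open>\<delta> annihilates the constant if \<open>e = 0\<close>; otherwise e \<ge> 2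
    puts the Frobenius bound e + pd beyond both recorded degrees pd and pd + 1.\<close>
  have "jet2 (fps_delta g (fps_const c * fps_X ^ e)) (p * d) 0 0"
  proof (cases "e = 0")
    case False
    hence "e \<ge> 2" using e p2 by (auto dest!: dvd_imp_le)
    thus ?thesis unfolding fps_delta_const_mult
      using fps_delta_X_power_char[OF g d0 g0 p e] by (auto simp: jet2_def)
  qed (simp add: fps_delta_def jet2_def)
  from jet2_delta_funpow_zero[OF g d0 this, of n]
  have 1: "jet2 ((fps_delta g ^^ (p - 1)) (fps_const c * fps_X ^ e)) (p * d) 0 0"
    unfolding n funpow_Suc_right o_apply by (rule jet2_zero_mono) simp
  obtain b where b: "jet2 ((fps_delta g ^^ n) u) (d + n * d) (k * c') b"
    using jet2_delta_funpow[OF g d0 u d1 d1, of n] by (auto simp: k_def)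
  have m: "d + n * d = (p - 1) * d" unfolding n by simp
  have m1: "of_nat ((p - 1) * d) = (- 1 :: 'a)"
    unfolding of_nat_mult d1 of_nat_char_diff1[OF p] by simp
  hence m2: "of_nat (Suc ((p - 1) * d)) = (0 :: 'a)"
    by simp
  have pd: "(p - 1) * d + d = p * d"
    using p2 by (cases p) auto
  define T where "T = - s + (if d = 1 then of_nat (((p - 1) * d) choose 2) * r\<^sup>2 else 0)"
  have "jet2 ((fps_delta g ^^ (p - 1)) u) (p * d) (k * c * c') (k * c' * T)"
  proof -
    have "jet2 (fps_delta g ((fps_delta g ^^ n) u)) (p * d) (- 1 * r * (k * c'))
        ((- 1 * s + (if d = 1 then of_nat (((p - 1) * d) choose 2) * r\<^sup>2 else 0)) * (k * c')
          + 0 * r * b)"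
      using jet2_delta[OF g d0 b] unfolding m m1 m2 pd .
    moreover have "- 1 * r * (k * c') = k * c * c'"
      by (simp add: r_def)
    moreover have "(- 1 * s + (if d = 1 then of_nat (((p - 1) * d) choose 2) * r\<^sup>2 else 0)) *
        (k * c') + 0 * r * b = k * c' * T"
      by (simp add: T_def)
    moreover have "fps_delta g ((fps_delta g ^^ n) u) = (fps_delta g ^^ (p - 1)) u"
      unfolding n by simp
    ultimately show ?thesis by (simp only:)
  qed
  \<comment> \<open>For e > 0, T = -s = c'. For e = 0, the c^2 in s is cancelled if p is odd, as
    \<open>(p - 1) choose 2\<close> is 1 in the field, and survives if p = 2, where the binomial is
    0.\<close>
  moreover have "T = (if e = 0 \<and> p = 2 then c' - c\<^sup>2 else c')"
    using of_nat_char_choose2[OF p] by (auto simp: T_def s_def r_def d_def numeral_2_eq_2)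
  ultimately have 2: "jet2 ((fps_delta g ^^ (p - 1)) u) (p * d) (k * c * c')
      (k * c' * (if e = 0 \<and> p = 2 then c' - c\<^sup>2 else c'))" by simp
  have "t = fps_const c * fps_X ^ e + u" by (simp add: u_def)
  hence "(fps_delta g ^^ (p - 1)) t =
      (fps_delta g ^^ (p - 1)) (fps_const c * fps_X ^ e) + (fps_delta g ^^ (p - 1)) u"
    by (metis fps_delta_funpow_add)
  with jet2_add[OF 1 2] have "jet2 ((fps_delta g ^^ (p - 1)) t) (p * Suc e) (k * c * c')
      (k * c' * (if e = 0 \<and> p = 2 then c' - c\<^sup>2 else c'))" by (simp add: d_def)
  moreover have "\<not> p dvd fact n"
    using p p2 by (simp add: prime_dvd_fact_iff n_def)
  hence "of_nat (fact n) \<noteq> (0::'a)"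
    using p by (simp add: of_nat_eq_0_iff_char_dvd del: of_nat_fact)
  hence "c \<noteq> 0 \<longrightarrow> k \<noteq> 0" by (simp add: k_def r_def)
  ultimately show ?thesis by blast
qed

text \<open>From g - \<zeta> = -\<zeta>tg and ord g = 1, dividing by \<zeta> leaves order ord t +
  1.\<close>

lemma fps_ord_inv_incr:
  assumes gt: "inv_incr g t" and g0: "fps_nth g 0 = 0"
  shows "fps_ord ((g - fps_X) div fps_X) = enat (Suc e) \<longleftrightarrow> (\<forall>k<e. fps_nth t k = 0) \<and> fps_nth t e \<noteq> 0"
proof -
  have gX: "g - fps_X = fps_X * - (t * g)"
    using gt unfolding inv_incr_def by (simp add: algebra_simps eq_diff_eq)
  have g1: "fps_nth g (Suc 0) = 1"
    using arg_cong[OF gX, of "\<lambda>x. fps_nth x 1"] g0 by (simp add: fps_mult_nth)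
  have sg: "g \<noteq> 0" "subdegree g = 1"
    using g1 g0 by (auto intro!: subdegreeI)
  have "(g - fps_X) div fps_X = - (t * g)"
    unfolding gX by (rule nonzero_mult_div_cancel_left) simp
  hence "fps_ord ((g - fps_X) div fps_X) = enat (Suc e) \<longleftrightarrow> t \<noteq> 0 \<and> subdegree t = e"
    using sg by (simp add: fps_ord_def)
  also have "\<dots> \<longleftrightarrow> (\<forall>k<e. fps_nth t k = 0) \<and> fps_nth t e \<noteq> 0"
    by (auto intro!: subdegreeI)
  finally show ?thesis .
qed

section \<open>The criterion for series tangent to the identity\<close>

definition ram_min :: "nat \<Rightarrow> nat \<Rightarrow> nat" where
  "ram_min p n = (p ^ (n + 1) - 1) div (p - 1)"

lemma ram_min_eq:
  assumes "p \<ge> 2"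
  shows "ram_min p n = (\<Sum>i\<le>n. p ^ i)"
proof -
  have "(p - 1) * (\<Sum>i\<le>n. p ^ i) + 1 = p ^ (n + 1)"
  proof (induction n)
    case (Suc n)
    have "(p - 1) * (\<Sum>i\<le>Suc n. p ^ i) + 1 = ((p - 1) * (\<Sum>i\<le>n. p ^ i) + 1) + (p - 1) * p ^ (n + 1)"
      by (simp add: algebra_simps)
    also have "\<dots> = (1 + (p - 1)) * p ^ (n + 1)"
      unfolding Suc.IH by (simp only: distrib_right mult_1)
    also have "\<dots> = p ^ (Suc n + 1)"
      using assms by simp
    finally show ?case .
  qed (use assms in auto)
  hence "p ^ (n + 1) - 1 = (p - 1) * (\<Sum>i\<le>n. p ^ i)" by simp
  thus ?thesis using assms unfolding ram_min_def by simp
qed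

lemma ram_min_0: "p \<ge> 2 \<Longrightarrow> ram_min p 0 = 1"
  by (simp add: ram_min_eq)

lemma ram_min_Suc: "p \<ge> 2 \<Longrightarrow> ram_min p (Suc n) = Suc (p * ram_min p n)"
  by (simp add: ram_min_eq sum.atMost_Suc_shift sum_distrib_left del: sum.atMost_Suc)

lemma ram_number_eq_ram_min_iff:
  fixes g :: "'a::field fps"
  assumes p: "prime p" "CHAR('a) = p" and g0: "fps_nth g 0 = 0" and g1: "fps_nth g 1 = 1"
  defines "c \<equiv> fps_nth g 2" and "c' \<equiv> (fps_nth g 2)\<^sup>2 - fps_nth g 3"
  shows "(\<forall>n. ram_number p n g = enat (ram_min p n)) \<longleftrightarrow>
           c \<noteq> 0 \<and> c' \<noteq> 0 \<and> (p = 2 \<longrightarrow> c' \<noteq> c\<^sup>2)"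
proof -
  have p2: "p \<ge> 2" using p prime_ge_2_nat by blast
  \<comment> \<open>The order of the increment t that makes i_n minimal. Its recursion e(n+1) =
    p(e(n) + 1) matches the exponent produced by the p-th iterate, and every value is a multiple of
    p.\<close>
  define e where "e n = ram_min p n - 1" for n
  have e: "ram_min p n = Suc (e n)" for n
    using p2 by (cases n) (simp_all add: e_def ram_min_0 ram_min_Suc)
  have e0: "e 0 = 0" and eS: "e (Suc n) = p * Suc (e n)" for n
    using ram_min_0[OF p2] ram_min_Suc[OF p2, of n] by (simp_all add: e)
  have dvd: "p dvd e n" for n
    by (cases n) (simp_all add: e0 eS)
  define G where "G n = fps_iter g (p ^ n)" for n
  have G0: "fps_nth (G n) 0 = 0" for n
    by (simp add: G_def g0 fps_iter_nth_0)
  have GS: "G (Suc n) = fps_iter (G n) p" for n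
    unfolding G_def using fps_iter_mult[OF g0, of "p ^ n" p] by (simp add: mult.commute)
  obtain t where t: "inv_incr g t" using ex_inv_incr[OF g0 g1] by blast
  have tg: "g * (1 + fps_X * t) = fps_X" using t by (simp add: inv_incr_def)
  have t0: "fps_nth t 0 = - c"
    using arg_cong[OF tg, of "\<lambda>x. fps_nth x 2"] g0 g1
    by (simp add: fps_mult_nth numeral_2_eq_2 c_def add_eq_0_iff)
  have t1: "fps_nth t 1 = c'"
    using arg_cong[OF tg, of "\<lambda>x. fps_nth x 3"] g0 g1 t0
    by (simp add: fps_mult_nth numeral_2_eq_2 numeral_3_eq_3 c_def c'_def add_eq_0_iff
        power2_eq_square algebra_simps)
  have step: "\<exists>u k. inv_incr (G (Suc n)) u \<and> (b \<noteq> 0 \<longrightarrow> k \<noteq> 0) \<and>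
      jet2 u (e (Suc n)) (k * b * b') (k * b' * (if n = 0 \<and> p = 2 then b' - b\<^sup>2 else b'))"
    if "inv_incr (G n) v" "jet2 v (e n) b b'" for n v b b'
  proof -
    have "e n = 0 \<longleftrightarrow> n = 0" using p2 by (cases n) (simp_all add: e0 eS)
    with jet2_delta_funpow_char[OF p G0 that dvd] obtain k where
      "b \<noteq> 0 \<longrightarrow> k \<noteq> 0" "jet2 ((fps_delta (G n) ^^ (p - 1)) v) (p * Suc (e n))
           (k * b * b') (k * b' * (if n = 0 \<and> p = 2 then b' - b\<^sup>2 else b'))"
      by auto
    with inv_incr_iter_char[OF that(1) G0 p] show ?thesis
      unfolding GS eS by blast
  qed
  have ram: "ram_number p n g = enat (ram_min p n) \<longleftrightarrow> b \<noteq> 0"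
    if "inv_incr (G n) v" "jet2 v (e n) b b'" for n v b b'
    using fps_ord_inv_incr[OF that(1) G0, of "e n"] that(2)
    by (simp add: ram_number_def G_def e jet2_def)
  have v0: "inv_incr (G 0) t" "jet2 t (e 0) (- c) c'"
    using t t0 t1 g0 by (simp_all add: G_def e0 jet2_def)
  show ?thesis
  proof
    \<comment> \<open>Necessity comes from n = 0, 1, 2: the leading coefficients there force in turn
      c, c' and, for p = 2, c' - c^2 to be nonzero.\<close>
    assume *: "\<forall>n. ram_number p n g = enat (ram_min p n)"
    have c: "c \<noteq> 0" using ram[OF v0] * by simp
    obtain u k where u: "inv_incr (G 1) u" "k \<noteq> 0"
      "jet2 u (e 1) (k * - c * c') (k * c' * (if p = 2 then c' - c\<^sup>2 else c'))"
      using step[OF v0, unfolded power2_minus] c by auto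
    have c': "c' \<noteq> 0" using ram[OF u(1,3)] * by simp
    obtain u2 k2 b where u2: "inv_incr (G (Suc 1)) u2"
      "jet2 u2 (e (Suc 1)) (k2 * (k * - c * c') * (k * c' * (if p = 2 then c' - c\<^sup>2 else c'))) b"
      using step[OF u(1,3)] by blast
    have "(if p = 2 then c' - c\<^sup>2 else c') \<noteq> 0" using ram[OF u2] * by auto
    thus "c \<noteq> 0 \<and> c' \<noteq> 0 \<and> (p = 2 \<longrightarrow> c' \<noteq> c\<^sup>2)" using c c' by auto
  next
    assume *: "c \<noteq> 0 \<and> c' \<noteq> 0 \<and> (p = 2 \<longrightarrow> c' \<noteq> c\<^sup>2)"
    \<comment> \<open>The invariant keeps both coefficients nonzero; its last clause guards the
      exceptional step out of n = 0 at p = 2.\<close>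
    have "\<exists>v b b'. inv_incr (G n) v \<and> jet2 v (e n) b b' \<and> b \<noteq> 0 \<and> b' \<noteq> 0 \<and>
        (n = 0 \<and> p = 2 \<longrightarrow> b' \<noteq> b\<^sup>2)" for n
    proof (induction n)
      case 0
      show ?case using v0 * by (intro exI[of _ t] exI[of _ "- c"] exI[of _ c']) auto
    next
      case (Suc n)
      then obtain v b b' where v: "inv_incr (G n) v" "jet2 v (e n) b b'" "b \<noteq> 0" "b' \<noteq> 0"
        "n = 0 \<and> p = 2 \<longrightarrow> b' \<noteq> b\<^sup>2" by blast
      from step[OF v(1,2)] obtain u k where "inv_incr (G (Suc n)) u" "k \<noteq> 0"
        "jet2 u (e (Suc n)) (k * b * b') (k * b' * (if n = 0 \<and> p = 2 then b' - b\<^sup>2 else b'))"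
        using v(3) by blast
      thus ?case using v
        by (intro exI[of _ u] exI[of _ "k * b * b'"]
            exI[of _ "k * b' * (if n = 0 \<and> p = 2 then b' - b\<^sup>2 else b')"]) auto
    qed
    thus "\<forall>n. ram_number p n g = enat (ram_min p n)" using ram by blast
  qed
qed

subsection \<open>Semiconjugacy\<close>

lemma fps_iter_semiconj:
  assumes H: "h oo f = g oo h" and 0: "fps_nth f 0 = 0" "fps_nth g 0 = 0" "fps_nth h 0 = (0::'a::field)"
  shows "h oo fps_iter f n = fps_iter g n oo h"
proof (induction n)
  case (Suc n)
  have "h oo fps_iter f (Suc n) = (h oo f) oo fps_iter f n"
    using 0 by (simp add: fps_iter_Suc fps_compose_assoc fps_iter_nth_0)
  also have "\<dots> = g oo (h oo fps_iter f n)"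
    using 0 by (simp add: H fps_compose_assoc fps_iter_nth_0)
  also have "\<dots> = fps_iter g (Suc n) oo h"
    using 0 by (simp add: Suc.IH fps_iter_Suc fps_compose_assoc fps_iter_nth_0)
  finally show ?case .
qed (use 0 in simp)

definition ram0 :: "'a::field fps \<Rightarrow> enat" where
  "ram0 g = fps_ord ((g - fps_X) div fps_X)"

lemma ram_number_altdef: "ram_number p n g = ram0 (fps_iter g (p ^ n))"
  by (simp add: ram_number_def ram0_def)

lemma ram0_X [simp]: "ram0 fps_X = \<infinity>"
  by (simp add: ram0_def fps_ord_def)

lemma ram0_eq:
  assumes "fps_nth g 0 = 0" "g \<noteq> fps_X"
  shows "ram0 g = enat (subdegree (g - fps_X) - 1)"
proof -
  define u where "u = fps_shift 1 (g - fps_X)"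
  have u: "g - fps_X = fps_X * u"
    using assms by (auto simp: u_def fps_eq_iff)
  with assms have u0: "u \<noteq> 0" by auto
  have "(g - fps_X) div fps_X = u"
    unfolding u by (rule nonzero_mult_div_cancel_left) simp
  moreover have "subdegree (g - fps_X) = Suc (subdegree u)"
    using u0 by (simp add: u)
  ultimately show ?thesis using u0 by (simp add: ram0_def fps_ord_def)
qed

lemma jet2_tangent:
  assumes "fps_nth g 0 = 0" "fps_nth g 1 = 1" "g \<noteq> fps_X"
  obtains d r s where "d > 0" "r \<noteq> 0" "jet2 (g - fps_X) (Suc d) r s"
    "subdegree (g - fps_X) = Suc d"
proof -
  have n0: "g - fps_X \<noteq> 0" using assms by simp
  have "subdegree (g - fps_X) \<ge> 2"
    using n0 assms by (intro subdegree_geI) (auto simp: less_Suc_eq numeral_2_eq_2)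
  then obtain d where d: "subdegree (g - fps_X) = Suc d" "d > 0"
    by (cases "subdegree (g - fps_X)") auto
  show ?thesis
  proof (rule that)
    show "fps_nth (g - fps_X) (Suc d) \<noteq> 0"
      using nth_subdegree_nonzero[OF n0] unfolding d .
    show "jet2 (g - fps_X) (Suc d) (fps_nth (g - fps_X) (Suc d)) (fps_nth (g - fps_X) (Suc (Suc d)))"
      unfolding jet2_def by (metis d(1) nth_less_subdegree_zero)
  qed (fact d)+
qed

text \<open>Compare orders in h o f - h = (g - \<zeta>) o h, with m = ord h. The left side has order
  m + i_0(f), its leading coefficient carrying the factor m, nonzero in the field; the right side
  has order m(1 + i_0(g)). So i_0(f) = m i_0(g).\<close>

lemma ram0_semiconj:
  fixes h f g :: "'a::field fps"
  assumes H: "h oo f = g oo h" and h: "fps_nth h 0 = 0" "h \<noteq> 0"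
    and f: "fps_nth f 0 = 0" "fps_nth f 1 = 1" and g: "fps_nth g 0 = 0"
    and r: "of_nat (subdegree h) \<noteq> (0::'a)"
  shows "ram0 f = enat (subdegree h * i) \<longleftrightarrow> ram0 g = enat i"
proof -
  define m where "m = subdegree h"
  have diff: "fps_delta f h = (g - fps_X) oo h"
    using h by (simp add: fps_delta_def fps_compose_sub_distrib H)
  show ?thesis
  proof (cases "f = fps_X")
    case True
    hence "(g - fps_X) oo h = 0" using diff by (simp add: fps_delta_def)
    hence "g = fps_X" using h by (simp add: fps_compose_eq_0_iff)
    thus ?thesis using True by simp
  next
    case False
    then obtain d a s where d: "d > 0" "a \<noteq> 0" "jet2 (f - fps_X) (Suc d) a s"
      "subdegree (f - fps_X) = Suc d" using jet2_tangent[OF f] by blast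
    have "jet2 h m (fps_nth h m) (fps_nth h (Suc m))"
      by (auto simp: jet2_def m_def)
    from jet2_delta[OF d(3,1) this] have j: "\<forall>k<m + d. fps_nth (fps_delta f h) k = 0"
      "fps_nth (fps_delta f h) (m + d) = of_nat m * a * fps_nth h m"
      unfolding jet2_def by auto
    hence nz: "fps_nth (fps_delta f h) (m + d) \<noteq> 0"
      using r h d by (simp add: m_def)
    hence "subdegree (fps_delta f h) = m + d"
      using j by (intro subdegreeI) auto
    hence md: "m + d = subdegree (g - fps_X) * m"
      using h by (simp add: diff m_def)
    have gX: "g \<noteq> fps_X" using nz diff by auto
    have m0: "m > 0" using r by (auto simp: m_def intro: gr0I)
    have "subdegree (g - fps_X) > 0" using md m0 by (auto intro: gr0I)
    then obtain e where e: "subdegree (g - fps_X) = Suc e"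
      by (cases "subdegree (g - fps_X)") auto
    have "d = m * e" using md unfolding e by simp
    thus ?thesis using ram0_eq[OF f(1) False] ram0_eq[OF g gX] d e m0
      by (simp flip: m_def)
  qed
qed

text \<open>If g = \<zeta> + r\<zeta>^(d+1) + ..., its n-th iterate is \<zeta> + nr\<zeta>^(d+1) +
  ..., and qr is nonzero.\<close>

lemma ram0_iter:
  fixes g :: "'a::field fps"
  assumes g: "fps_nth g 0 = 0" "fps_nth g 1 = 1" and q: "of_nat q \<noteq> (0::'a)"
  shows "ram0 (fps_iter g q) = ram0 g"
proof (cases "g = fps_X")
  case True
  have "fps_iter (fps_X :: 'a fps) q = fps_X"
    by (induction q) (simp_all add: fps_iter_Suc)
  thus ?thesis using True by simp
next
  case False
  then obtain d r s where d: "d > 0" "r \<noteq> 0" "jet2 (g - fps_X) (Suc d) r s"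
    "subdegree (g - fps_X) = Suc d" using jet2_tangent[OF g] by blast
  have *: "\<exists>s'. jet2 (fps_iter g n - fps_X) (Suc d) (of_nat n * r) s'" for n
  proof (induction n)
    case 0
    show ?case by (auto simp: jet2_def)
  next
    case (Suc n)
    then obtain s' where s': "jet2 (fps_iter g n - fps_X) (Suc d) (of_nat n * r) s'" by blast
    have "fps_iter g (Suc n) = fps_iter g n oo g"
      using fps_iter_add[OF g(1), of n 1] g(1) by simp
    hence "fps_iter g (Suc n) - fps_X =
        (fps_iter g n - fps_X) + (g - fps_X) + fps_delta g (fps_iter g n - fps_X)"
      using g by (simp add: fps_delta_def fps_compose_sub_distrib)
    moreover have "\<exists>b. jet2 (fps_delta g (fps_iter g n - fps_X)) (Suc d) 0 b"
      using jet2_delta[OF d(3,1) s'] d(1) by (auto simp: jet2_def)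
    then obtain b where b: "jet2 (fps_delta g (fps_iter g n - fps_X)) (Suc d) 0 b" ..
    ultimately have "jet2 (fps_iter g (Suc n) - fps_X) (Suc d) (of_nat n * r + r + 0) (s' + s + b)"
      using jet2_add[OF jet2_add[OF s' d(3)] b] by (simp only:)
    thus ?case by (auto simp: algebra_simps)
  qed
  from *[of q] obtain s' where s': "jet2 (fps_iter g q - fps_X) (Suc d) (of_nat q * r) s'" by blast
  have "subdegree (fps_iter g q - fps_X) = Suc d"
    using s' q d by (intro subdegreeI) (auto simp: jet2_def)
  moreover from this have "fps_iter g q \<noteq> fps_X" by auto
  ultimately show ?thesis
    using False d g by (simp add: ram0_eq fps_iter_nth_0)
qed

subsection \<open>Resonant normal form\<close>

lemma fps_power_nth_cong_less:
  assumes "\<forall>k<n. fps_nth f k = fps_nth g k" "k < n"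
  shows "fps_nth (f ^ i) k = fps_nth ((g :: 'a::field fps) ^ i) k"
  using assms(2)
proof (induction i arbitrary: k)
  case (Suc i)
  show ?case unfolding power_Suc fps_mult_nth
  proof (intro sum.cong refl)
    fix l assume "l \<in> {0..k}"
    hence "l < n" "k - l < n" using Suc.prems by auto
    thus "fps_nth f l * fps_nth (f ^ i) (k - l) = fps_nth g l * fps_nth (g ^ i) (k - l)"
      using assms(1) Suc.IH by simp
  qed
qed simp

text \<open>For i \<ge> 2 the degree-n coefficient of f could enter degree n of f^i only multiplied
  by a constant term, which is 0.\<close>

lemma fps_power_nth_cong_le:
  assumes "\<forall>k<n. fps_nth f k = fps_nth g k" "k \<le> n" "i \<ge> 2"
    and 0: "fps_nth f 0 = 0" "fps_nth g 0 = 0"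
  shows "fps_nth (f ^ i) k = fps_nth ((g :: 'a::field fps) ^ i) k"
proof -
  obtain j where j: "i = Suc j" "j > 0" using assms(3) by (cases i) auto
  have "(\<Sum>l=0..k. fps_nth f l * fps_nth (f ^ j) (k - l))
      = (\<Sum>l=0..k. fps_nth g l * fps_nth (g ^ j) (k - l))"
  proof (intro sum.cong refl)
    fix l assume l: "l \<in> {0..k}"
    consider "l = 0" | "l = k" | "0 < l" "l < n" "k - l < n"
      using l assms(2) by fastforce
    thus "fps_nth f l * fps_nth (f ^ j) (k - l) = fps_nth g l * fps_nth (g ^ j) (k - l)"
    proof cases
      case 3
      thus ?thesis using assms(1) fps_power_nth_cong_less[OF assms(1)] by simp
    qed (use 0 j in \<open>simp_all add: fps_power_zeroth zero_power\<close>)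
  qed
  thus ?thesis by (simp add: j fps_mult_nth)
qed

lemma fps_power_nth_same:
  assumes "fps_nth f 0 = 0"
  shows "fps_nth (f ^ n) n = fps_nth (f :: 'a::field fps) 1 ^ n"
proof -
  have "f = fps_X * fps_shift 1 f" using assms by (auto simp: fps_eq_iff)
  hence "f ^ n = fps_X ^ n * fps_shift 1 f ^ n"
    by (metis power_mult_distrib)
  thus ?thesis by (simp add: fps_X_power_mult_nth fps_power_zeroth)
qed

text \<open>In degree n, the correction \<open>u\<close> changes h o f by u f_1^n and g o h by g_1
  u, and \<open>v\<close> adds v to the latter; \<open>D\<close> balances these changes. Lower
  degrees are untouched.\<close>

lemma conj_normal_form_step:
  fixes f g h :: "'a::field fps"
  assumes f: "fps_nth f 0 = 0" and h: "fps_nth h 0 = 0" "fps_nth h 1 = 1"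
    and eq: "\<forall>k<n. fps_nth (h oo f) k = fps_nth (g oo h) k" and n: "n \<ge> 2"
    and D: "fps_nth (h oo f) n - fps_nth (g oo h) n + u * fps_nth f 1 ^ n - fps_nth g 1 * u - v = 0"
  defines "h' \<equiv> h + fps_const u * fps_X ^ n" and "g' \<equiv> g + fps_const v * fps_X ^ n"
  shows "\<forall>k\<le>n. fps_nth (h' oo f) k = fps_nth (g' oo h') k"
proof (intro allI impI)
  fix k assume k: "k \<le> n"
  have h': "fps_nth h' 0 = 0" "fps_nth h' 1 = 1" using h n by (simp_all add: h'_def)
  have agree: "\<forall>k<n. fps_nth h' k = fps_nth h k" by (simp add: h'_def)
  have pw: "fps_nth (F ^ n) k = (if k = n then fps_nth F 1 ^ n else 0)"
    if "fps_nth F 0 = 0" for F :: "'a fps"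
  proof (cases "k = n")
    case False
    with k have "k < n" by simp
    thus ?thesis using startsby_zero_power_prefix[OF that, of n] False by simp
  qed (simp add: fps_power_nth_same[OF that])
  have comp: "fps_const c * fps_X ^ n oo F = fps_const c * F ^ n" if "fps_nth F 0 = 0"
    for c and F :: "'a fps"
    using that by (simp add: fps_compose_mult_distrib fps_X_power_compose)
  have "fps_nth (g oo h') k - fps_nth (g oo h) k =
      (\<Sum>i=0..k. fps_nth g i * (fps_nth (h' ^ i) k - fps_nth (h ^ i) k))"
    by (simp add: fps_compose_nth sum_subtractf algebra_simps)
  also have "\<dots> = (\<Sum>i=0..k. if i = 1 then (if k = n then fps_nth g 1 * u else 0) else 0)"
  proof (intro sum.cong refl)
    fix i assume "i \<in> {0..k}"
    consider "i = 0" | "i = 1" | "i \<ge> 2" by linarith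
    thus "fps_nth g i * (fps_nth (h' ^ i) k - fps_nth (h ^ i) k) =
        (if i = 1 then (if k = n then fps_nth g 1 * u else 0) else 0)"
    proof cases
      case 3
      thus ?thesis using fps_power_nth_cong_le[OF agree k 3 h'(1) h(1)] by simp
    qed (auto simp: h'_def)
  qed
  also have "\<dots> = (if k = n then fps_nth g 1 * u else 0)"
    using n by simp
  finally have 1: "fps_nth (g oo h') k = fps_nth (g oo h) k + (if k = n then fps_nth g 1 * u else 0)"
    by (simp add: algebra_simps)
  have 2: "fps_nth (g' oo h') k = fps_nth (g oo h') k + (if k = n then v else 0)"
    using h' by (simp add: g'_def fps_compose_add_distrib comp pw)
  have 3: "fps_nth (h' oo f) k = fps_nth (h oo f) k + (if k = n then u * fps_nth f 1 ^ n else 0)"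
    using f by (simp add: h'_def fps_compose_add_distrib comp pw)
  show "fps_nth (h' oo f) k = fps_nth (g' oo h') k"
  proof (cases "k = n")
    case True
    have "fps_nth (h oo f) n + u * fps_nth f 1 ^ n = fps_nth (g oo h) n + fps_nth g 1 * u + v"
    proof -
      have "x + y = z + w + v" if "x - z + y - w - v = 0" for x y z w :: 'a
        using that by (simp add: algebra_simps)
      from this[OF D] show ?thesis .
    qed
    thus ?thesis unfolding 1 2 3 using True by (simp only: refl if_True)
  next
    case False
    thus ?thesis unfolding 1 2 3 using eq k by simp
  qed
qed

text \<open>In degree j + 1 the homological equation is D + u(c^(j+1) - c) = v. It is solvable with
  v = 0 unless c^j = 1, that is q | j, so only these resonant terms stay in g.\<close>

lemma ex_conj_resonant:
  fixes f :: "'a::field fps"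
  assumes f: "fps_nth f 0 = 0" "fps_nth f 1 = c"
    and c: "c \<noteq> 0" "c ^ q = 1" "\<And>n. c ^ n = 1 \<Longrightarrow> q dvd n"
  shows "\<exists>h g. fps_nth h 0 = 0 \<and> fps_nth h 1 = 1 \<and> fps_nth g 0 = 0 \<and> fps_nth g 1 = c \<and>
    (\<forall>k. \<not> q dvd k \<longrightarrow> fps_nth g (Suc k) = 0) \<and> h oo f = g oo h"
proof -
  define P where "P n x \<longleftrightarrow> (case x of (h, g) \<Rightarrow>
      fps_nth h 0 = 0 \<and> fps_nth h 1 = 1 \<and> fps_nth g 0 = 0 \<and> fps_nth g 1 = c \<and>
      (\<forall>k. \<not> q dvd k \<longrightarrow> fps_nth g (Suc k) = 0) \<and>
      (\<forall>k<n + 2. fps_nth (h oo f) k = fps_nth (g oo h) k))"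
    for n :: nat and x :: "'a fps \<times> 'a fps"
  define Q where "Q n x y \<longleftrightarrow>
      (\<forall>k<n + 2. fps_nth (fst x) k = fps_nth (fst y) k \<and> fps_nth (snd x) k = fps_nth (snd y) k)"
    for n :: nat and x y :: "'a fps \<times> 'a fps"
  have "\<exists>S. \<forall>n. P n (S n) \<and> Q n (S n) (S (Suc n))"
  proof (rule dependent_nat_choice)
    have "P 0 (fps_X, fps_const c * fps_X)"
      using f by (auto simp: P_def less_Suc_eq numeral_2_eq_2 fps_compose_mult_distrib)
    thus "\<exists>x. P 0 x" ..
  next
    fix x n assume "P n x"
    then obtain h g where x: "x = (h, g)" and h: "fps_nth h 0 = 0" "fps_nth h 1 = 1"
      and g: "fps_nth g 0 = 0" "fps_nth g 1 = c" "\<forall>k. \<not> q dvd k \<longrightarrow> fps_nth g (Suc k) = 0"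
      and eq: "\<forall>k<n + 2. fps_nth (h oo f) k = fps_nth (g oo h) k"
      by (auto simp: P_def)
    define D where "D = fps_nth (h oo f) (n + 2) - fps_nth (g oo h) (n + 2)"
    obtain u v where uv: "D + u * c ^ (n + 2) - c * u - v = 0" "\<not> q dvd n + 1 \<longrightarrow> v = 0"
    proof (cases "q dvd n + 1")
      case True
      thus ?thesis using that[of 0 D] by simp
    next
      case False
      hence "c ^ (n + 1) \<noteq> 1" using c(3) by blast
      hence "c ^ (n + 2) \<noteq> c" using c(1) by simp
      thus ?thesis using that[of "D / (c - c ^ (n + 2))" 0]
        by (simp add: divide_simps) (simp add: algebra_simps)
    qed
    define h' where "h' = h + fps_const u * fps_X ^ (n + 2)"
    define g' where "g' = g + fps_const v * fps_X ^ (n + 2)"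
    have "\<forall>k\<le>n + 2. fps_nth (h' oo f) k = fps_nth (g' oo h') k"
      unfolding h'_def g'_def
      by (rule conj_normal_form_step[OF f(1) h eq]) (use uv f g in \<open>simp_all add: D_def\<close>)
    hence "P (Suc n) (h', g') \<and> Q n x (h', g')"
      using h g uv(2) unfolding P_def Q_def x by (auto simp: h'_def g'_def less_Suc_eq_le)
    thus "\<exists>y. P (Suc n) y \<and> Q n x y" ..
  qed
  then obtain S where P: "P n (S n)" and Q: "Q n (S n) (S (Suc n))" for n by blast
  have mono: "Q n (S n) (S (n + m))" for n m
  proof (induction m)
    case (Suc m)
    thus ?case using Q[of "n + m"] by (auto simp: Q_def)
  qed (simp add: Q_def)
  \<comment> \<open>Coefficient k no longer changes from stage k on, so the diagonal gives the limit
    series.\<close>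
  define h where "h = Abs_fps (\<lambda>k. fps_nth (fst (S k)) k)"
  define g where "g = Abs_fps (\<lambda>k. fps_nth (snd (S k)) k)"
  have S: "fps_nth h k = fps_nth (fst (S n)) k" "fps_nth g k = fps_nth (snd (S n)) k"
    if "k \<le> n" for k n
    using mono[of k "n - k"] that by (simp_all add: Q_def h_def g_def)
  have "fps_nth (h oo f) k = fps_nth (g oo h) k" for k
  proof -
    have "fps_nth (h oo f) k = fps_nth (fst (S k) oo f) k"
      by (simp add: fps_compose_nth S)
    also have "\<dots> = fps_nth (snd (S k) oo fst (S k)) k"
      using P[of k, unfolded P_def case_prod_unfold] by simp
    also have "\<dots> = fps_nth (g oo h) k"
      unfolding fps_compose_nth
    proof (intro sum.cong refl arg_cong2[where f = "(*)"])
      fix i assume "i \<in> {0..k}"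
      show "fps_nth (fst (S k) ^ i) k = fps_nth (h ^ i) k"
        by (rule fps_power_nth_cong_less[where n = "Suc k"]) (auto simp: S[of _ k])
    qed (auto simp: S[of _ k])
    finally show ?thesis .
  qed
  hence "h oo f = g oo h" by (simp add: fps_eq_iff)
  moreover have "fps_nth h 0 = 0" "fps_nth h 1 = 1" "fps_nth g 0 = 0" "fps_nth g 1 = c"
    using P[of 1, unfolded P_def case_prod_unfold] S[of 0 1] S[of 1 1] by simp_all
  moreover have "fps_nth g (Suc k) = 0" if "\<not> q dvd k" for k
    using P[of "Suc k", unfolded P_def case_prod_unfold] S(2)[of "Suc k" "Suc k"] that by simp
  ultimately show ?thesis by blast
qed

subsection \<open>The iterative residue\<close>

lemma mult_order_props:
  assumes "parabolic f" and q: "q = mult_order (fps_nth f 1)"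
  shows "q > 0" "fps_nth f 1 ^ q = 1" "\<And>n. fps_nth f 1 ^ n = 1 \<Longrightarrow> q dvd n"
proof -
  let ?c = "fps_nth f 1"
  obtain n where "n > 0 \<and> ?c ^ n = 1" using assms by (auto simp: parabolic_def)
  hence *: "q > 0 \<and> ?c ^ q = 1" unfolding q mult_order_def by (rule LeastI)
  thus "q > 0" "?c ^ q = 1" by auto
  fix n assume n: "?c ^ n = 1"
  have "?c ^ n = ?c ^ (q * (n div q) + n mod q)" by simp
  also have "\<dots> = (?c ^ q) ^ (n div q) * ?c ^ (n mod q)"
    by (simp only: power_add power_mult)
  finally have "?c ^ (n mod q) = 1" using * n by simp
  moreover have "n mod q < q" using * by simp
  ultimately have "n mod q = 0"
    using not_less_Least[of "n mod q" "\<lambda>n. n > 0 \<and> ?c ^ n = 1"]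
    unfolding q mult_order_def by auto
  thus "q dvd n" by auto
qed

text \<open>If q = pm, Frobenius gives (c^m - 1)^p = c^q - 1 = 0, hence c^m = 1 with 0 < m <
  q.\<close>

lemma mult_order_coprime_char:
  fixes f :: "'a::field fps"
  assumes f: "parabolic f" and q: "q = mult_order (fps_nth f 1)" and p: "prime p" "CHAR('a) = p"
  shows "of_nat q \<noteq> (0::'a)"
proof
  assume "of_nat q = (0::'a)"
  then obtain m where m: "q = p * m" using p by (auto simp: of_nat_eq_0_iff_char_dvd)
  let ?c = "fps_nth f 1"
  have "(?c ^ m - 1 + 1) ^ p = (?c ^ m - 1) ^ p + 1 ^ p"
    by (rule freshmans_dream) (use p in auto)
  moreover have "(?c ^ m) ^ p = 1"
    using mult_order_props(2)[OF f q] by (simp add: m mult.commute flip: power_mult)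
  ultimately have "(?c ^ m - 1) ^ p = 0" by simp
  hence "?c ^ m = 1" by simp
  hence "q dvd m" by (rule mult_order_props(3)[OF f q])
  moreover have "m > 0" using mult_order_props(1)[OF f q] m by (auto intro: gr0I)
  ultimately have "q \<le> m" by (rule dvd_imp_le)
  thus False using m \<open>m > 0\<close> prime_gt_1_nat[OF p(1)] by simp
qed

text \<open>The resonant exponents are 1 + jq, so a resonant form is a normal series. This justifies
  the choice of \<open>A\<close> in \<open>resit\<close>.\<close>

lemma ex_normal_series:
  fixes f :: "'a::field fps"
  assumes f: "parabolic f" and q: "q = mult_order (fps_nth f 1)"
  shows "\<exists>A. fps_nth A 0 = 0 \<and> fps_conjugate f (normal_series (fps_nth f 1) q A)"
proof -
  let ?c = "fps_nth f 1"
  note ord = mult_order_props[OF f q]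
  have c: "?c \<noteq> 0" using ord(1,2) by (auto simp: zero_power)
  obtain h g where hg: "fps_nth h 0 = 0" "fps_nth h 1 = 1" "fps_nth g 0 = 0" "fps_nth g 1 = ?c"
    "\<And>k. \<not> q dvd k \<Longrightarrow> fps_nth g (Suc k) = 0" "h oo f = g oo h"
    using ex_conj_resonant[OF _ refl c ord(2,3)] f unfolding parabolic_def by blast
  define A where "A = Abs_fps (\<lambda>j. if j = 0 then 0 else fps_nth g (Suc (j * q)) / ?c)"
  have "normal_series ?c q A = g"
  proof (rule fps_ext)
    fix n
    show "fps_nth (normal_series ?c q A) n = fps_nth g n"
    proof (cases n)
      case (Suc k)
      have "fps_nth (normal_series ?c q A) n = ?c * (fps_nth 1 k + fps_nth (A oo fps_X ^ q) k)"
        by (simp add: normal_series_def Suc mult.assoc)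
      also have "\<dots> = fps_nth g (Suc k)"
        using ord(1) c hg by (auto simp: fps_nth_compose_X_power A_def)
      finally show ?thesis by (simp add: Suc)
    qed (use hg in \<open>simp add: normal_series_def mult.assoc\<close>)
  qed
  hence "fps_conjugate f (normal_series ?c q A)"
    using hg unfolding fps_conjugate_def by (intro exI[of _ h]) auto
  moreover have "fps_nth A 0 = 0" by (simp add: A_def)
  ultimately show ?thesis by blast
qed

text \<open>As c^q = 1, raising to the q-th power carries the normal series to one tangent to the
  identity; the witness \<open>h ^ q\<close> is the conjugacy followed by this map.\<close>

lemma normal_series_semiconj:
  fixes f :: "'a::field fps"
  assumes N: "fps_conjugate f (normal_series c q A)" and q: "q > 0" "c ^ q = 1"
    and f: "fps_nth f 0 = 0"
  shows "\<exists>H. fps_nth H 0 = 0 \<and> H \<noteq> 0 \<and> subdegree H = q \<and> H oo f = (fps_X * (1 + A) ^ q) oo H"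
proof -
  obtain h where h: "fps_nth h 0 = 0" "fps_nth h 1 \<noteq> 0" "h oo f = normal_series c q A oo h"
    using N by (auto simp: fps_conjugate_def)
  have hs: "subdegree h = 1" "h \<noteq> 0" using h by (auto intro!: subdegreeI)
  have X0: "fps_nth (fps_X ^ q :: 'a fps) 0 = 0" using q by simp
  have 1: "normal_series c q A ^ q = (fps_X * (1 + A) ^ q) oo fps_X ^ q"
    using X0 q by (simp add: normal_series_def power_mult_distrib fps_const_power
        fps_compose_mult_distrib fps_compose_add_distrib flip: fps_compose_power)
  have "h ^ q oo f = (normal_series c q A oo h) ^ q"
    by (simp add: fps_compose_power[OF f, symmetric] h(3))
  also have "\<dots> = (fps_X * (1 + A) ^ q) oo (fps_X ^ q oo h)"
    by (simp add: fps_compose_power[OF h(1)] 1 fps_compose_assoc[OF h(1) X0])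
  also have "fps_X ^ q oo h = h ^ q"
    by (simp add: fps_X_power_compose h(1))
  finally have "h ^ q oo f = (fps_X * (1 + A) ^ q) oo h ^ q" .
  thus ?thesis using h hs q by (intro exI[of _ "h ^ q"]) (simp add: fps_power_zeroth zero_power)
qed

text \<open>Iterating f and F both q p^n times relates their i_0 by the factor q = ord H; the
  surplus q-fold iteration of F leaves i_0 unchanged because q is nonzero in the field.\<close>

lemma ram_number_semiconj:
  fixes f F H :: "'a::field fps"
  assumes H: "fps_nth H 0 = 0" "H \<noteq> 0" "subdegree H = q" "H oo f = F oo H"
    and f: "fps_nth f 0 = 0" "fps_nth f 1 ^ q = 1" and q: "of_nat q \<noteq> (0::'a)"
    and F: "fps_nth F 0 = 0" "fps_nth F 1 = 1"
  shows "ram_number p n (fps_iter f q) = enat (q * i) \<longleftrightarrow> ram_number p n F = enat i"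
proof -
  define m where "m = q * p ^ n"
  have "H oo fps_iter f m = fps_iter F m oo H"
    by (rule fps_iter_semiconj) (use H f F in auto)
  hence "ram0 (fps_iter f m) = enat (q * i) \<longleftrightarrow> ram0 (fps_iter F m) = enat i"
    using ram0_semiconj[of H "fps_iter f m" "fps_iter F m" i] H f F q
    by (simp add: fps_iter_nth_0 fps_iter_nth_1 m_def power_mult)
  moreover have "fps_iter f m = fps_iter (fps_iter f q) (p ^ n)"
    by (simp add: m_def fps_iter_mult f)
  moreover have "fps_iter F m = fps_iter (fps_iter F (p ^ n)) q"
    unfolding m_def by (subst mult.commute) (simp add: fps_iter_mult F)
  moreover have "ram0 (fps_iter (fps_iter F (p ^ n)) q) = ram0 (fps_iter F (p ^ n))"
    by (rule ram0_iter) (use F q in \<open>simp_all add: fps_iter_nth_0 fps_iter_nth_1\<close>)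
  ultimately show ?thesis by (simp add: ram_number_altdef)
qed

lemma fps_power_nth_1_2:
  assumes "fps_nth B 0 = (1::'a::field)"
  shows "fps_nth (B ^ n) 1 = of_nat n * fps_nth B 1"
    and "fps_nth (B ^ n) 2 = of_nat n * fps_nth B 2 + of_nat (n choose 2) * (fps_nth B 1)\<^sup>2"
proof -
  show 1: "fps_nth (B ^ n) 1 = of_nat n * fps_nth B 1" for n
    by (induction n) (use assms in \<open>auto simp: fps_mult_nth fps_power_zeroth algebra_simps\<close>)
  show "fps_nth (B ^ n) 2 = of_nat n * fps_nth B 2 + of_nat (n choose 2) * (fps_nth B 1)\<^sup>2"
  proof (induction n)
    case (Suc n)
    have "fps_nth (B ^ Suc n) 2 = fps_nth (B ^ n) 2 + fps_nth B 1 * fps_nth (B ^ n) 1 + fps_nth B 2"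
      using assms by (simp add: fps_mult_nth numeral_2_eq_2 fps_power_zeroth)
    also have "\<dots> = of_nat (Suc n) * fps_nth B 2 + of_nat (Suc n choose 2) * (fps_nth B 1)\<^sup>2"
      unfolding Suc.IH 1 by (simp add: numeral_2_eq_2 algebra_simps)
    finally show ?case .
  qed (simp add: numeral_2_eq_2)
qed

text \<open>Doubled, this is \<open>2 * (q choose 2) + q = q * q\<close>. In characteristic 2 the
  halving is done in the integers before passing to the field.\<close>

lemma half_succ_mult:
  assumes "of_nat q \<noteq> (0::'a::field)"
  shows "of_nat q * half_succ q = (of_nat q)\<^sup>2 - (of_nat (q choose 2) :: 'a)"
proof -
  have *: "2 * (q choose 2) + q = q * q"
    by (induction q) (simp_all add: numeral_2_eq_2)
  show ?thesis
  proof (cases "CHAR('a) = 2")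
    case True
    hence "odd q" using assms by (simp add: of_nat_eq_0_iff_char_dvd)
    then obtain m where m: "q = 2 * m + 1" by (rule oddE)
    have "(q choose 2) = m * q" using * by (simp add: m algebra_simps)
    hence "q * ((q + 1) div 2) + (q choose 2) = q * q" by (simp add: m algebra_simps)
    hence "of_nat q * of_nat ((q + 1) div 2) + of_nat (q choose 2) = (of_nat q * of_nat q :: 'a)"
      by (metis of_nat_add of_nat_mult)
    thus ?thesis using True by (simp add: half_succ_def power2_eq_square algebra_simps)
  next
    case False
    have 2: "(2::'a) \<noteq> 0"
    proof
      assume "(2::'a) = 0"
      hence "CHAR('a) dvd 2" by (metis of_nat_eq_0_iff_char_dvd of_nat_numeral)
      hence "CHAR('a) = 1 \<or> CHAR('a) = 2" using prime_nat_iff two_is_prime_nat by blast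
      thus False using False by simp
    qed
    have "2 * of_nat (q choose 2) + of_nat q = (of_nat q * of_nat q :: 'a)"
      using arg_cong[OF *, of "of_nat :: nat \<Rightarrow> 'a"] by simp
    moreover have "2 * (of_nat q * half_succ q) = of_nat q * (of_nat q + (1::'a))"
      using False 2 by (simp add: half_succ_def algebra_simps)
    ultimately have "2 * (of_nat q * half_succ q) = 2 * ((of_nat q)\<^sup>2 - (of_nat (q choose 2) :: 'a))"
      by (simp add: power2_eq_square algebra_simps)
    thus ?thesis using mult_left_cancel[OF 2] by blast
  qed
qed

text \<open>For a normal form \<open>N\<close> of \<open>f\<close> with coefficient series \<open>A\<close>, the identity
  \<open>N(\<zeta>)\<^sup>q = F(\<zeta>\<^sup>q)\<close> holds with \<open>F(\<zeta>) = \<zeta>(1 + A(\<zeta>))\<^sup>q\<close>.\<close>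

lemma ex_tangent_semiconj:
  fixes f :: "'a::field fps"
  assumes p: "prime p" "CHAR('a) = p" and f: "parabolic f" and q: "q = mult_order (fps_nth f 1)"
  shows "\<exists>F H. fps_nth F 0 = 0 \<and> fps_nth F 1 = 1 \<and>
    fps_nth H 0 = 0 \<and> H \<noteq> 0 \<and> subdegree H = q \<and> H oo f = F oo H \<and>
    (fps_nth F 2 \<noteq> 0 \<longrightarrow>
       of_nat q * ((fps_nth F 2)\<^sup>2 - fps_nth F 3) = (fps_nth F 2)\<^sup>2 * resit f)"
proof (cases "fps_nth f 1 = 1")
  case True
  have "mult_order (1::'a) = 1" unfolding mult_order_def by (rule Least_equality) auto
  hence "q = 1" using q True by simp
  \<comment> \<open>For q = 1 the series f itself serves as \<open>F\<close>, with H =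
    \<zeta>.\<close>
  thus ?thesis using True f
    by (intro exI[of _ f] exI[of _ fps_X])
      (auto simp: parabolic_def resit_def Let_def field_simps)
next
  case False
  note ord = mult_order_props[OF f q]
  let ?c = "fps_nth f 1"
  define A where "A = (SOME A. fps_nth A 0 = 0 \<and> fps_conjugate f (normal_series ?c q A))"
  have A: "fps_nth A 0 = 0" "fps_conjugate f (normal_series ?c q A)"
    using someI_ex[OF ex_normal_series[OF f q]] unfolding A_def by auto
  define a where "a = fps_nth A 1"
  define b where "b = fps_nth A 2"
  have res: "resit f = half_succ q - b / a\<^sup>2"
    using False by (simp add: resit_def Let_def A_def a_def b_def q)
  define F where "F = fps_X * (1 + A) ^ q"
  have B: "fps_nth (1 + A) 0 = 1" using A by simp
  have F: "fps_nth F 0 = 0" "fps_nth F 1 = 1" "fps_nth F 2 = of_nat q * a"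
    "fps_nth F 3 = of_nat q * b + of_nat (q choose 2) * a\<^sup>2"
    using fps_power_nth_1_2[OF B, of q] A
    by (simp_all add: F_def fps_power_zeroth a_def b_def)
  have q0: "of_nat q \<noteq> (0::'a)" by (rule mult_order_coprime_char[OF f q p])
  have "of_nat q * ((fps_nth F 2)\<^sup>2 - fps_nth F 3) = (fps_nth F 2)\<^sup>2 * resit f" if "fps_nth F 2 \<noteq> 0"
  proof -
    have "a \<noteq> 0" using that F by auto
    \<comment> \<open>The target F_2^2 - F_3 is a^2(q^2 - (q choose 2)) - qb, whose bracket is q
      times (q + 1)/2.\<close>
    hence "a\<^sup>2 * (of_nat q * resit f) = a\<^sup>2 * (of_nat q * half_succ q) - of_nat q * b"
      by (simp add: res field_simps)
    also have "\<dots> = (fps_nth F 2)\<^sup>2 - fps_nth F 3"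
      unfolding half_succ_mult[OF q0] F by (simp add: algebra_simps power2_eq_square)
    finally have "(fps_nth F 2)\<^sup>2 - fps_nth F 3 = a\<^sup>2 * (of_nat q * resit f)" ..
    thus ?thesis by (simp add: F power2_eq_square)
  qed
  moreover obtain H where "fps_nth H 0 = 0" "H \<noteq> 0" "subdegree H = q" "H oo f = F oo H"
    using normal_series_semiconj[OF A(2) ord(1,2)] f unfolding F_def parabolic_def by blast
  ultimately show ?thesis using F by blast
qed

lemma ram_number_0_eq_1_iff:
  assumes "fps_nth F 0 = 0" "fps_nth F 1 = 1"
  shows "ram_number p 0 F = enat 1 \<longleftrightarrow> fps_nth F 2 \<noteq> 0"
proof -
  obtain t where t: "inv_incr F t" using ex_inv_incr[OF assms] by blast
  hence tF: "F * (1 + fps_X * t) = fps_X" by (simp add: inv_incr_def)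
  have "fps_nth F 2 = - fps_nth t 0"
    using arg_cong[OF tF, of "\<lambda>x. fps_nth x 2"] assms
    by (simp add: fps_mult_nth numeral_2_eq_2 eq_neg_iff_add_eq_0 add.commute)
  thus ?thesis using fps_ord_inv_incr[OF t assms(1), of 0] assms
    by (simp add: ram_number_def)
qed

theorem theoremD:
  fixes p q :: nat and f :: "'a::field fps"
  assumes "prime p"
    and "CHAR('a) = p"
    and "parabolic f"
    and "q = mult_order (fps_nth f 1)"
  shows "(odd p \<longrightarrow>
           (minimally_ramified p f \<longleftrightarrow>
              ram_number p 0 (fps_iter f q) = enat q \<and> resit f \<noteq> 0)) \<and>
         (p = 2 \<longrightarrow>
           (minimally_ramified p f \<longleftrightarrow>
              ram_number p 0 (fps_iter f q) = enat q \<and> resit f \<noteq> 0 \<and> resit f \<noteq> 1))"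
proof -
  have q0: "of_nat q \<noteq> (0::'a)"
    by (rule mult_order_coprime_char[OF assms(3,4,1,2)])
  obtain F H where F: "fps_nth F 0 = 0" "fps_nth F 1 = 1"
    and H: "fps_nth H 0 = 0" "H \<noteq> 0" "subdegree H = q" "H oo f = F oo H"
    and res: "fps_nth F 2 \<noteq> 0 \<Longrightarrow>
       of_nat q * ((fps_nth F 2)\<^sup>2 - fps_nth F 3) = (fps_nth F 2)\<^sup>2 * resit f"
    using ex_tangent_semiconj[OF assms] by blast
  have ram: "ram_number p n (fps_iter f q) = enat (q * i) \<longleftrightarrow> ram_number p n F = enat i" for n i
    by (rule ram_number_semiconj[OF H])
      (use assms(3) mult_order_props(2)[OF assms(3,4)] q0 F in \<open>auto simp: parabolic_def\<close>)
  \<comment> \<open>Taking i = 1 turns i_0(f^q) = q into i_0(F) = 1.\<close>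
  have 0: "ram_number p 0 (fps_iter f q) = enat q \<longleftrightarrow> fps_nth F 2 \<noteq> 0"
    using ram[of 0 1] ram_number_0_eq_1_iff[OF F] by simp
  have "minimally_ramified p f \<longleftrightarrow> (\<forall>n. ram_number p n F = enat (ram_min p n))"
    using assms(3) unfolding minimally_ramified_def Let_def assms(4)[symmetric]
      ram_min_def[symmetric] ram by simp
  also have "\<dots> \<longleftrightarrow> fps_nth F 2 \<noteq> 0 \<and> (fps_nth F 2)\<^sup>2 - fps_nth F 3 \<noteq> 0 \<and>
      (p = 2 \<longrightarrow> (fps_nth F 2)\<^sup>2 - fps_nth F 3 \<noteq> (fps_nth F 2)\<^sup>2)"
    by (rule ram_number_eq_ram_min_iff[OF assms(1,2) F])
  also have "\<dots> \<longleftrightarrow> fps_nth F 2 \<noteq> 0 \<and> resit f \<noteq> 0 \<and> (p = 2 \<longrightarrow> resit f \<noteq> 1)"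
  proof (cases "fps_nth F 2 = 0")
    case False
    note res = res[OF False]
    have "(fps_nth F 2)\<^sup>2 - fps_nth F 3 \<noteq> 0 \<longleftrightarrow> resit f \<noteq> 0"
      using res q0 False by (metis mult_eq_0_iff power_not_zero)
    \<comment> \<open>Here q is odd, hence 1 in the field, and \<open>res\<close> becomes F_2^2 -
      F_3 = F_2^2 \<open>resit f\<close>.\<close>
    moreover have "(fps_nth F 2)\<^sup>2 - fps_nth F 3 \<noteq> (fps_nth F 2)\<^sup>2 \<longleftrightarrow> resit f \<noteq> 1" if "p = 2"
    proof -
      have "odd q" using q0 that assms(2) by (simp add: of_nat_eq_0_iff_char_dvd)
      then obtain m where m: "q = 2 * m + 1" by (rule oddE)
      have "of_nat (2 * m) = (0::'a)"
        unfolding of_nat_eq_0_iff_char_dvd using that assms(2) by simp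
      hence "of_nat q = (1::'a)"
        unfolding m of_nat_add by (simp only: of_nat_1 add_0_left)
      with res False show ?thesis by auto
    qed
    ultimately show ?thesis by blast
  qed simp
  finally have "minimally_ramified p f \<longleftrightarrow>
      fps_nth F 2 \<noteq> 0 \<and> resit f \<noteq> 0 \<and> (p = 2 \<longrightarrow> resit f \<noteq> 1)" .
  thus ?thesis using 0 by auto
qed

end
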